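(* Let $\Omega\subset\mathbb{R}^3$ be an open bounded domain with polytopal boundary and let $\mathcal{T}$ be a conforming simplicial (tetrahedral) triangulation of $\overline\Omega$ with vertices $v_1,\dots,v_V$. For each $i$ let $e_i$ be the number of edges of $\mathcal{T}$ intersecting at $v_i$, and let $\overline{e}=\frac1V\sum_{i=1}^V e_i$. Then for any interior vertex $v_i\notin\partial\Omega$ one has $$e_i\geq 4.$$ Furthermore, if $\Omega$ is pathwise connected and $\mathcal{T}$ has at least one interior vertex, then $$\overline{e}\geq 4.$$
   Context: A conforming tetrahedral triangulation of $\overline\Omega$ is a finite set of closed non-degenerate tetrahedra whose union is $\overline\Omega$ and such that any two distinct tetrahedra intersect in the empty set, a common vertex, a common edge or a common (triangular) face. A vertex is interior if it does not lie on $\partial\Omega$. If $E$ is the number of edges of $\mathcal{T}$, then $\overline{e}=2E/V$. *)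

theory Defs
  imports "HOL-Analysis.Analysis"
begin

text \<open>The polytopes below may have any dimension. For the boundary of an open set, which has
  empty interior, only dimensions at most two can occur, and no regularity of the boundary
  (such as being a manifold) is imposed.\<close>

definition polytopal_boundary :: "(real^3) set \<Rightarrow> bool" where
  "polytopal_boundary \<Omega> \<longleftrightarrow>
     (\<exists>\<P>. finite \<P> \<and> (\<forall>P\<in>\<P>. polytope P) \<and> frontier \<Omega> = \<Union>\<P>)"

definition conforming_tetrahedral_triangulation ::
    "(real^3) set \<Rightarrow> (real^3) set set \<Rightarrow> bool" where
  "conforming_tetrahedral_triangulation \<Omega> \<T> \<longleftrightarrow>
     finite \<T> \<and>
     (\<forall>T\<in>\<T>. 3 simplex T) \<and>
     \<Union>\<T> = closure \<Omega> \<and>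
     (\<forall>T\<in>\<T>. \<forall>T'\<in>\<T>. T \<noteq> T' \<longrightarrow>
        T \<inter> T' = {} \<or>
        (\<exists>v. T \<inter> T' = {v} \<and> v extreme_point_of T \<and> v extreme_point_of T') \<or>
        (T \<inter> T' edge_of T \<and> T \<inter> T' edge_of T') \<or>
        (T \<inter> T' facet_of T \<and> T \<inter> T' facet_of T'))"

definition tri_vertices :: "(real^3) set set \<Rightarrow> (real^3) set" where
  "tri_vertices \<T> = {v. \<exists>T\<in>\<T>. v extreme_point_of T}"

definition tri_edges :: "(real^3) set set \<Rightarrow> (real^3) set set" where
  "tri_edges \<T> = {e. \<exists>T\<in>\<T>. e edge_of T}"

definition vertex_degree :: "(real^3) set set \<Rightarrow> real^3 \<Rightarrow> nat" where
  "vertex_degree \<T> v = card {e \<in> tri_edges \<T>. v \<in> e}"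

definition average_degree :: "(real^3) set set \<Rightarrow> real" where
  "average_degree \<T> =
     (\<Sum>v\<in>tri_vertices \<T>. real (vertex_degree \<T> v)) / real (card (tri_vertices \<T>))"

text \<open>Sanity checks: a conforming triangulation is one in the sense of the library, and
  the cardinalities and sums above range over finite sets.\<close>

lemma conforming_imp_triangulation:
  assumes "conforming_tetrahedral_triangulation \<Omega> \<T>"
  shows "triangulation \<T>"
proof -
  note D = assms[unfolded conforming_tetrahedral_triangulation_def]
  have spx: "3 simplex T" if "T \<in> \<T>" for T
    using D that by simp
  have "T \<inter> T' face_of T" if "T \<in> \<T>" "T' \<in> \<T>" for T T'
  proof (cases "T = T'")
    case True
    with convex_simplex[OF spx[OF that(1)]] show ?thesis
      by (simp add: face_of_refl)
  next
    case False
    from D have "\<forall>T\<in>\<T>. \<forall>T'\<in>\<T>. T \<noteq> T' \<longrightarrow>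
        T \<inter> T' = {} \<or>
        (\<exists>v. T \<inter> T' = {v} \<and> v extreme_point_of T \<and> v extreme_point_of T') \<or>
        (T \<inter> T' edge_of T \<and> T \<inter> T' edge_of T') \<or>
        (T \<inter> T' facet_of T \<and> T \<inter> T' facet_of T')"
      by (elim conjE)
    from this[rule_format, OF that False] show ?thesis
    proof (elim disjE exE conjE)
      assume "T \<inter> T' = {}"
      then show ?thesis by simp
    next
      fix v assume "T \<inter> T' = {v}" "v extreme_point_of T"
      then show ?thesis by (simp only: face_of_singleton)
    next
      assume "T \<inter> T' edge_of T"
      then show ?thesis by (simp only: edge_of_def)
    next
      assume "T \<inter> T' facet_of T"
      then show ?thesis by (simp only: facet_of_def)
    qed
  qed
  moreover have "finite \<T>"
    using D by (elim conjE)
  ultimately show ?thesis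
    unfolding triangulation_def by (intro conjI ballI allI impI exI) (auto intro: spx)
qed

lemma finite_tri_vertices_edges:
  assumes "conforming_tetrahedral_triangulation \<Omega> \<T>"
  shows finite_tri_vertices: "finite (tri_vertices \<T>)"
    and finite_tri_edges: "finite (tri_edges \<T>)"
proof -
  note D = assms[unfolded conforming_tetrahedral_triangulation_def]
  have "finite \<T>"
    using D by (elim conjE)
  moreover have "finite {F. F face_of T}" if "T \<in> \<T>" for T
  proof -
    have "3 simplex T"
      using D that by simp
    then show ?thesis
      by (intro finite_polytope_faces simplex_imp_polytope)
  qed
  ultimately have fin: "finite (\<Union>T\<in>\<T>. {F. F face_of T})"
    by (intro finite_UN_I)
  have "tri_edges \<T> \<subseteq> (\<Union>T\<in>\<T>. {F. F face_of T})"
    unfolding tri_edges_def edge_of_def by fast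
  then show "finite (tri_edges \<T>)"
    using fin by (rule finite_subset)
  have "(\<lambda>v. {v}) ` tri_vertices \<T> \<subseteq> (\<Union>T\<in>\<T>. {F. F face_of T})"
    unfolding tri_vertices_def face_of_singleton[symmetric] by fast
  then have "finite ((\<lambda>v. {v}) ` tri_vertices \<T>)"
    using fin by (rule finite_subset)
  then show "finite (tri_vertices \<T>)"
    by (rule finite_imageD) simp
qed

end

theory Submission
  imports Defs
begin

text \<open>
  Both inequalities come from one local fact. Let \<open>F\<close> be a face of the triangulation that is
  spanned by a vertex set \<open>B\<close> and that has a vertex in the interior of the triangulated region
  (\<open>face_link_card\<close>). Then \<open>F\<close> has a relative interior point in the interior of the region. The
  simplices that contain this point all contain \<open>F\<close>, and they cover a neighbourhood, so every
  vector is a linear combination of directions inside \<open>F\<close> plus a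
  \<^emph>\<open>nonnegative\<close> combination of directions towards the remaining vertices of these simplices, which
  form the link of \<open>B\<close>. Expressing minus the sum of the link directions in this way yields a
  linear dependency, so the spanning set has more elements than the dimension. In three-space this
  says that an interior vertex has at least four neighbours, and that an edge which
  issues from an interior vertex is surrounded by at least three vertices.

  For the average, start with the set \<open>S\<close> of an interior vertex \<open>v\<close> and its \<open>n \<ge> 4\<close> neighbours.
  Counting only edges inside \<open>S\<close>, the vertex \<open>v\<close> has degree \<open>n\<close> and each neighbour has degree at
  least \<open>1 + 3\<close>, so the degree sum is at least \<open>5 * n \<ge> 4 * (n + 1)\<close>. Now enlarge \<open>S\<close> greedily.
  A new vertex with two neighbours in \<open>S\<close> increases the degree sum by at least four, so the bound
  \<open>4 * card S\<close> persists. Such a vertex exists as long as some tetrahedron has at least two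
  vertices in \<open>S\<close> but not all of them. Otherwise the tetrahedra inside \<open>S\<close> and all the others meet in
  finitely many points only; but deleting finitely many points does not disconnect the domain
  (\<open>finite_overlap_imp_trivial_split\<close>), so \<open>S\<close> contains every vertex.
\<close>

section \<open>Simplices of a triangulation and their vertices\<close>

abbreviation verts :: "'a::euclidean_space set \<Rightarrow> 'a set" where
  "verts T \<equiv> {x. x extreme_point_of T}"

lemma simplex_verts:
  assumes "n simplex T"
  shows "\<not> affine_dependent (verts T)" and "int (card (verts T)) = n + 1"
    and "T = convex hull verts T" and "finite (verts T)"
proof -
  obtain C where C: "\<not> affine_dependent C" "int (card C) = n + 1" "T = convex hull C"
    using assms unfolding simplex_def by blast
  then have "verts T = C"
    by (simp add: extreme_point_of_convex_hull_affine_independent)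
  with C show "\<not> affine_dependent (verts T)" "int (card (verts T)) = n + 1"
    "T = convex hull verts T" "finite (verts T)"
    by (auto simp: aff_independent_finite)
qed

lemma triangulation_simplex:
  assumes "triangulation \<T>" "T \<in> \<T>"
  obtains n where "n simplex T"
  using assms unfolding triangulation_def by blast

lemma triangulation_hull_verts:
  assumes "triangulation \<T>" "T \<in> \<T>"
  shows "T = convex hull verts T" and "finite (verts T)"
  using triangulation_simplex[OF assms] simplex_verts by metis+

lemma triangulation_Int_face:
  assumes "triangulation \<T>" "T \<in> \<T>" "T' \<in> \<T>"
  shows "T \<inter> T' face_of T"
  using assms unfolding triangulation_def by blast

text \<open>Extremality passes from \<open>T\<close> to the common face and from there to \<open>T'\<close>.\<close>

lemma triangulation_vertex_in_simplex:
  assumes tri: "triangulation \<T>" and T: "T \<in> \<T>" "T' \<in> \<T>"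
    and x: "x extreme_point_of T" "x \<in> T'"
  shows "x extreme_point_of T'"
proof -
  have "T \<inter> T' face_of T" "T \<inter> T' face_of T'"
    using triangulation_Int_face[OF tri T] triangulation_Int_face[OF tri T(2,1)]
    by (simp_all add: Int_commute)
  moreover have "x \<in> T"
    using x(1) by (simp add: extreme_point_of_def)
  ultimately show ?thesis
    using x by (metis IntI extreme_point_of_face)
qed

text \<open>A common face is spanned by vertices of either simplex, and those lying in the other one are
  vertices there. So the number of common vertices controls the size of the intersection.\<close>

lemma triangulation_Int_eq_hull:
  assumes tri: "triangulation \<T>" and T: "T \<in> \<T>" "T' \<in> \<T>"
  shows "T \<inter> T' = convex hull (verts T \<inter> verts T')"
proof
  obtain n where n: "n simplex T"
    using triangulation_simplex[OF tri T(1)] .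
  have "T \<inter> T' face_of convex hull (verts T)"
    using triangulation_Int_face[OF tri T] simplex_verts(3)[OF n] by simp
  then obtain C where C: "C \<subseteq> verts T" "T \<inter> T' = convex hull C"
    using face_of_convex_hull_affine_independent[OF simplex_verts(1)[OF n]] by blast
  have "C \<subseteq> T'"
    using C(2) hull_subset[of C convex] by auto
  then have "C \<subseteq> verts T'"
    using C(1) triangulation_vertex_in_simplex[OF tri T] by blast
  with C show "T \<inter> T' \<subseteq> convex hull (verts T \<inter> verts T')"
    by (simp add: hull_mono)
  show "convex hull (verts T \<inter> verts T') \<subseteq> T \<inter> T'"
    using triangulation_hull_verts(1)[OF tri T(1)] triangulation_hull_verts(1)[OF tri T(2)]
      hull_mono[of "verts T \<inter> verts T'" "verts T" convex]
      hull_mono[of "verts T \<inter> verts T'" "verts T'" convex]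
    by auto
qed

section \<open>Links of faces that meet the interior\<close>

text \<open>Minus the sum of the vectors over \<open>A\<close> is itself such a combination. Moving everything to
  one side gives each vector over \<open>A\<close> a positive coefficient, so any one of them may be removed
  from the spanning set.\<close>

lemma semi_positive_span_card:
  fixes f :: "'b \<Rightarrow> 'a::euclidean_space"
  assumes fin: "finite A" "finite B" and a0: "a0 \<in> A"
    and cover: "\<And>d. \<exists>c \<beta>. (\<forall>a\<in>A. 0 \<le> c a) \<and>
      d = (\<Sum>a\<in>A. c a *\<^sub>R f a) + (\<Sum>b\<in>B. \<beta> b *\<^sub>R f b)"
  shows "DIM('a) < card A + card B"
proof -
  let ?X = "f ` (A - {a0}) \<union> f ` B"
  have in_A: "f a \<in> span ?X" if "a \<in> A - {a0}" for a
    using that by (intro span_base) blast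
  have in_B: "f b \<in> span ?X" if "b \<in> B" for b
    using that by (intro span_base) blast
  obtain c \<beta> where c: "\<forall>a\<in>A. 0 \<le> c a" and
    eq: "- (\<Sum>a\<in>A. f a) = (\<Sum>a\<in>A. c a *\<^sub>R f a) + (\<Sum>b\<in>B. \<beta> b *\<^sub>R f b)"
    using cover by blast
  have "(\<Sum>a\<in>A. (1 + c a) *\<^sub>R f a) + (\<Sum>b\<in>B. \<beta> b *\<^sub>R f b) = 0"
    using eq by (simp add: scaleR_add_left sum.distrib algebra_simps neg_eq_iff_add_eq_0)
  then have "(1 + c a0) *\<^sub>R f a0
      = - ((\<Sum>a\<in>A - {a0}. (1 + c a) *\<^sub>R f a) + (\<Sum>b\<in>B. \<beta> b *\<^sub>R f b))"
    by (simp add: sum.remove[OF fin(1) a0] add.assoc add_eq_0_iff2)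
  also have "\<dots> \<in> span ?X"
    by (intro span_neg span_add span_sum span_scale in_A in_B)
  finally have "inverse (1 + c a0) *\<^sub>R ((1 + c a0) *\<^sub>R f a0) \<in> span ?X"
    by (rule span_scale)
  moreover have "1 + c a0 \<noteq> 0"
    using c a0 by (smt (verit))
  ultimately have "f a0 \<in> span ?X"
    by simp
  then have in_A': "f a \<in> span ?X" if "a \<in> A" for a
    using in_A that by blast
  have "d \<in> span ?X" for d
  proof -
    obtain c \<beta> where d: "d = (\<Sum>a\<in>A. c a *\<^sub>R f a) + (\<Sum>b\<in>B. \<beta> b *\<^sub>R f b)"
      using cover by blast
    show ?thesis
      unfolding d by (intro span_add span_sum span_scale in_A' in_B)
  qed
  then have "dim (UNIV :: 'a set) \<le> card ?X"
    using fin by (intro dim_le_card) auto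
  also have "\<dots> \<le> card (f ` (A - {a0})) + card (f ` B)"
    by (rule card_Un_le)
  also have "\<dots> \<le> card (A - {a0}) + card B"
    using fin by (intro add_mono card_image_le) auto
  also have "\<dots> < card A + card B"
    using card_Diff1_less[OF fin(1) a0] by (rule add_less_mono1)
  finally show ?thesis
    by simp
qed

text \<open>Near \<open>m\<close> only the members that contain \<open>m\<close> are present, because the others form a
  closed set avoiding \<open>m\<close>.\<close>

lemma closed_cover_direction:
  fixes m :: "'a::real_normed_vector"
  assumes "finite \<T>" and closed: "\<And>T. T \<in> \<T> \<Longrightarrow> closed T" and m: "m \<in> interior (\<Union>\<T>)"
  obtains T \<epsilon> where "T \<in> \<T>" "m \<in> T" "\<epsilon> > 0" "m + \<epsilon> *\<^sub>R d \<in> T"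
proof -
  define U where "U = interior (\<Union>\<T>) - \<Union>{T \<in> \<T>. m \<notin> T}"
  have "open U"
    unfolding U_def using assms by (intro open_Diff closed_Union) auto
  moreover have "m \<in> U"
    using m by (auto simp: U_def)
  ultimately obtain r where r: "r > 0" "ball m r \<subseteq> U"
    using open_contains_ball by blast
  define \<epsilon> where "\<epsilon> = r / (2 * (norm d + 1))"
  have pos: "norm d + 1 > 0"
    using norm_ge_zero[of d] by linarith
  then have "\<epsilon> > 0"
    using r by (simp add: \<epsilon>_def)
  have "\<epsilon> * norm d < \<epsilon> * (2 * (norm d + 1))"
    using \<open>\<epsilon> > 0\<close> norm_ge_zero[of d] by (simp add: mult_less_cancel_left_pos add_strict_increasing2)
  also have "\<dots> = r"
    using pos by (simp add: \<epsilon>_def)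
  finally have "m + \<epsilon> *\<^sub>R d \<in> U"
    using r \<open>\<epsilon> > 0\<close> by (intro subsetD[OF r(2)]) (simp add: dist_norm)
  then obtain T where "T \<in> \<T>" "m + \<epsilon> *\<^sub>R d \<in> T" "m \<in> T"
    using interior_subset by (fastforce simp: U_def)
  with \<open>\<epsilon> > 0\<close> that show ?thesis
    by blast
qed

definition link :: "'a::euclidean_space set set \<Rightarrow> 'a set \<Rightarrow> 'a set" where
  "link \<T> B = {a. a \<notin> B \<and> (\<exists>T\<in>\<T>. insert a B \<subseteq> verts T)}"

lemma finite_link:
  assumes "triangulation \<T>"
  shows "finite (link \<T> B)"
proof -
  have "link \<T> B \<subseteq> (\<Union>T\<in>\<T>. verts T)"
    by (auto simp: link_def)
  moreover have "finite (\<Union>T\<in>\<T>. verts T)"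
    using assms triangulation_hull_verts(2)[OF assms]
    by (auto simp: triangulation_def)
  ultimately show ?thesis
    by (rule finite_subset)
qed

text \<open>A relative interior point \<open>m\<close> of the face close to \<open>v\<close> still lies in the interior of the
  region, and a simplex that contains \<open>m\<close> contains the whole face. Barycentric coordinates of
  points near \<open>m\<close> with respect to these simplices give the directions required for counting.
  They are taken relative to \<open>v\<close>, so the vertices \<open>B - {v}\<close> span the directions inside the
  face.\<close>

lemma face_link_card:
  fixes \<T> :: "'a::euclidean_space set set"
  assumes tri: "triangulation \<T>" and v: "v \<in> interior (\<Union>\<T>)" "v \<in> B"
    and T0: "T0 \<in> \<T>" "B \<subseteq> verts T0" and ne: "link \<T> B \<noteq> {}"
  shows "DIM('a) + 2 \<le> card (link \<T> B) + card B"
proof -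
  have fin: "finite \<T>"
    using tri by (simp add: triangulation_def)
  have closed: "closed T" if "T \<in> \<T>" for T
    using triangulation_simplex[OF tri that] closed_simplex by blast
  have finB: "finite B"
    using finite_subset[OF T0(2) triangulation_hull_verts(2)[OF tri T0(1)]] .
  \<comment> \<open>The vertex \<open>v\<close> itself would not do: simplices that contain \<open>v\<close> may miss the rest of \<open>B\<close>.\<close>
  have "v \<in> closure (rel_interior (convex hull B))"
    using v(2) closure_subset hull_inc
    by (metis convex_closure_rel_interior convex_convex_hull subsetD)
  then obtain m where m: "m \<in> rel_interior (convex hull B)" "m \<in> interior (\<Union>\<T>)"
    using v(1) open_Int_closure_eq_empty[of "interior (\<Union>\<T>)" "rel_interior (convex hull B)"]
    by auto
  have hullB: "convex hull B \<subseteq> T0"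
    using triangulation_hull_verts(1)[OF tri T0(1)] hull_mono[OF T0(2), of convex] by simp
  have star: "B \<subseteq> verts T" if T: "T \<in> \<T>" "m \<in> T" for T
  proof -
    have "m \<in> T0"
      using m(1) rel_interior_subset hullB by blast
    then have "convex hull B \<subseteq> T0 \<inter> T"
      using m(1) T(2) by (intro subset_of_face_of[OF triangulation_Int_face[OF tri T0(1) T(1)] hullB]) auto
    then have "B \<subseteq> T"
      using hull_subset[of B convex] by blast
    then show ?thesis
      using T0(2) triangulation_vertex_in_simplex[OF tri T0(1) T(1)] by blast
  qed
  obtain \<mu> where \<mu>: "sum \<mu> B = 1" "m = (\<Sum>b\<in>B. \<mu> b *\<^sub>R b)"
    using m(1) rel_interior_subset[of "convex hull B"] convex_hull_finite[OF finB] by auto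
  obtain a0 where a0: "a0 \<in> link \<T> B"
    using ne by blast
  have "DIM('a) < card (link \<T> B) + card (B - {v})"
  proof (rule semi_positive_span_card[where f = "\<lambda>x. x - v", OF finite_link[OF tri] _ a0])
    show "finite (B - {v})"
      using finB by simp
    fix d :: 'a
    obtain T \<epsilon> where T: "T \<in> \<T>" "m \<in> T" and \<epsilon>: "\<epsilon> > 0" "m + \<epsilon> *\<^sub>R d \<in> T"
      using closed_cover_direction[OF fin closed m(2)] .
    have finT: "finite (verts T)"
      using triangulation_hull_verts(2)[OF tri T(1)] .
    have BT: "B \<subseteq> verts T"
      using star[OF T] .
    have "m + \<epsilon> *\<^sub>R d \<in> convex hull verts T"
      using \<epsilon>(2) triangulation_hull_verts(1)[OF tri T(1)] by blast
    then obtain u where u: "\<forall>x\<in>verts T. 0 \<le> u x" "sum u (verts T) = 1"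
        "(\<Sum>x\<in>verts T. u x *\<^sub>R x) = m + \<epsilon> *\<^sub>R d"
      unfolding convex_hull_finite[OF finT] by blast
    \<comment> \<open>The simplex depends on \<open>d\<close>, so its coefficients are extended by zero to the whole link.\<close>
    define c where "c a = (if a \<in> verts T then u a / \<epsilon> else 0)" for a
    define \<beta> where "\<beta> b = (u b - \<mu> b) / \<epsilon>" for b
    have sub: "verts T - B \<subseteq> link \<T> B"
      using BT T(1) by (auto simp: link_def)
    have "(\<Sum>a\<in>link \<T> B. c a *\<^sub>R (a - v)) = (\<Sum>a\<in>verts T - B. c a *\<^sub>R (a - v))"
      by (rule sum.mono_neutral_right[OF finite_link[OF tri] sub])
        (auto simp: c_def link_def)
    also have "\<dots> = (\<Sum>a\<in>verts T - B. (u a / \<epsilon>) *\<^sub>R (a - v))"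
      by (intro sum.cong) (auto simp: c_def)
    finally have cs: "\<epsilon> *\<^sub>R (\<Sum>a\<in>link \<T> B. c a *\<^sub>R (a - v))
        = (\<Sum>a\<in>verts T - B. u a *\<^sub>R (a - v))"
      using \<epsilon>(1) by (simp add: scaleR_sum_right)
    have "(\<Sum>b\<in>B - {v}. \<beta> b *\<^sub>R (b - v)) = (\<Sum>b\<in>B. \<beta> b *\<^sub>R (b - v))"
      using finB by (intro sum.mono_neutral_left) auto
    then have bs: "\<epsilon> *\<^sub>R (\<Sum>b\<in>B - {v}. \<beta> b *\<^sub>R (b - v))
        = (\<Sum>b\<in>B. u b *\<^sub>R (b - v)) - (\<Sum>b\<in>B. \<mu> b *\<^sub>R (b - v))"
      using \<epsilon>(1) by (simp add: \<beta>_def scaleR_sum_right sum_subtractf[symmetric]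
          scaleR_left_diff_distrib[symmetric])
    have us: "(\<Sum>x\<in>verts T. u x *\<^sub>R (x - v)) = m + \<epsilon> *\<^sub>R d - v"
      using u by (simp add: scaleR_right_diff_distrib sum_subtractf scaleR_sum_left[symmetric])
    have ms: "(\<Sum>b\<in>B. \<mu> b *\<^sub>R (b - v)) = m - v"
      using \<mu> by (simp add: scaleR_right_diff_distrib sum_subtractf scaleR_sum_left[symmetric])
    have "\<epsilon> *\<^sub>R d = (\<Sum>x\<in>verts T. u x *\<^sub>R (x - v)) - (\<Sum>b\<in>B. \<mu> b *\<^sub>R (b - v))"
      unfolding us ms by simp
    also have "(\<Sum>x\<in>verts T. u x *\<^sub>R (x - v))
        = (\<Sum>a\<in>verts T - B. u a *\<^sub>R (a - v)) + (\<Sum>b\<in>B. u b *\<^sub>R (b - v))"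
      by (rule sum.subset_diff[OF BT finT])
    finally have "\<epsilon> *\<^sub>R d = \<epsilon> *\<^sub>R ((\<Sum>a\<in>link \<T> B. c a *\<^sub>R (a - v))
        + (\<Sum>b\<in>B - {v}. \<beta> b *\<^sub>R (b - v)))"
      unfolding scaleR_add_right cs bs by (simp only: add_diff_eq)
    then have "d = (\<Sum>a\<in>link \<T> B. c a *\<^sub>R (a - v)) + (\<Sum>b\<in>B - {v}. \<beta> b *\<^sub>R (b - v))"
      using \<epsilon>(1) by simp
    moreover have "\<forall>a\<in>link \<T> B. 0 \<le> c a"
      using u(1) \<epsilon>(1) by (auto simp: c_def)
    ultimately show "\<exists>c \<beta>. (\<forall>a\<in>link \<T> B. 0 \<le> c a) \<and>
        d = (\<Sum>a\<in>link \<T> B. c a *\<^sub>R (a - v)) + (\<Sum>b\<in>B - {v}. \<beta> b *\<^sub>R (b - v))"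
      by blast
  qed
  moreover have "card B = Suc (card (B - {v}))"
    using card_Suc_Diff1[OF finB v(2)] by simp
  ultimately show ?thesis
    by simp
qed

section \<open>Degrees as numbers of neighbours\<close>

abbreviation nbrs :: "'a::euclidean_space set set \<Rightarrow> 'a \<Rightarrow> 'a set" where
  "nbrs \<T> v \<equiv> link \<T> {v}"

lemma nbrs_iff: "w \<in> nbrs \<T> v \<longleftrightarrow> w \<noteq> v \<and> (\<exists>T\<in>\<T>. v \<in> verts T \<and> w \<in> verts T)"
  by (auto simp: link_def)

lemma nbrs_sym: "w \<in> nbrs \<T> v \<longleftrightarrow> v \<in> nbrs \<T> w"
  by (auto simp: nbrs_iff)

lemma edge_of_simplex:
  fixes T :: "'a::euclidean_space set"
  assumes "n simplex T"
  shows "e edge_of T \<longleftrightarrow> (\<exists>x\<in>verts T. \<exists>y\<in>verts T. x \<noteq> y \<and> e = closed_segment x y)"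
proof -
  let ?C = "verts T"
  note C = simplex_verts[OF assms]
  have "e edge_of T \<longleftrightarrow> (\<exists>D\<subseteq>?C. e = convex hull D) \<and> aff_dim e = 1"
    using face_of_convex_hull_affine_independent[OF C(1), of e] C(3) by (simp add: edge_of_def)
  also have "\<dots> \<longleftrightarrow> (\<exists>D\<subseteq>?C. e = convex hull D \<and> card D = 2)"
  proof -
    have "aff_dim (convex hull D) = 1 \<longleftrightarrow> card D = 2" if "D \<subseteq> ?C" for D
      using aff_dim_affine_independent[OF affine_independent_subset[OF C(1) that]]
      by (simp add: aff_dim_convex_hull) linarith
    then show ?thesis
      by blast
  qed
  also have "\<dots> \<longleftrightarrow> (\<exists>x\<in>?C. \<exists>y\<in>?C. x \<noteq> y \<and> e = closed_segment x y)"
  proof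
    assume "\<exists>D\<subseteq>?C. e = convex hull D \<and> card D = 2"
    then obtain x y where "{x, y} \<subseteq> ?C" "e = convex hull {x, y}" "x \<noteq> y"
      unfolding card_2_iff by blast
    then show "\<exists>x\<in>?C. \<exists>y\<in>?C. x \<noteq> y \<and> e = closed_segment x y"
      by (auto simp: segment_convex_hull)
  next
    assume "\<exists>x\<in>?C. \<exists>y\<in>?C. x \<noteq> y \<and> e = closed_segment x y"
    then obtain x y where "x \<in> ?C" "y \<in> ?C" "x \<noteq> y" "e = closed_segment x y"
      by blast
    then show "\<exists>D\<subseteq>?C. e = convex hull D \<and> card D = 2"
      by (intro exI[of _ "{x, y}"]) (simp add: segment_convex_hull)
  qed
  finally show ?thesis .
qed

text \<open>An edge through a vertex of the triangulation has it as an endpoint: the vertex is extreme in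
  every simplex that contains it, hence also in the edge.\<close>

lemma vertex_degree_eq_card_nbrs:
  assumes tri: "triangulation \<T>" and v: "v \<in> tri_vertices \<T>"
  shows "vertex_degree \<T> v = card (nbrs \<T> v)"
proof -
  have "inj_on (closed_segment v) (nbrs \<T> v)"
    by (rule inj_onI) (auto simp: closed_segment_eq doubleton_eq_iff)
  moreover have "closed_segment v ` nbrs \<T> v = {e \<in> tri_edges \<T>. v \<in> e}"
  proof (intro equalityI subsetI)
    fix e assume "e \<in> closed_segment v ` nbrs \<T> v"
    then obtain w T where w: "w \<noteq> v" "T \<in> \<T>" "v \<in> verts T" "w \<in> verts T" "e = closed_segment v w"
      by (auto simp: nbrs_iff)
    obtain n where "n simplex T"
      using triangulation_simplex[OF tri w(2)] .
    with w have "e edge_of T"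
      by (auto simp: edge_of_simplex)
    then show "e \<in> {e \<in> tri_edges \<T>. v \<in> e}"
      using w by (auto simp: tri_edges_def)
  next
    fix e assume "e \<in> {e \<in> tri_edges \<T>. v \<in> e}"
    then obtain T where T: "T \<in> \<T>" "e edge_of T" "v \<in> e"
      by (auto simp: tri_edges_def)
    then have face: "e face_of T"
      by (simp add: edge_of_def)
    obtain n where "n simplex T"
      using triangulation_simplex[OF tri T(1)] .
    then obtain x y where xy: "x \<in> verts T" "y \<in> verts T" "x \<noteq> y" "e = closed_segment x y"
      using T(2) edge_of_simplex by blast
    have "v \<in> T"
      using T(3) face_of_imp_subset[OF face] by blast
    then have "v extreme_point_of T"
      using v T(1) triangulation_vertex_in_simplex[OF tri] unfolding tri_vertices_def by blast
    then have "v extreme_point_of e"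
      using T(3) extreme_point_of_face[OF face] by simp
    then have "v = x \<or> v = y"
      using xy(4) by (simp add: extreme_point_of_segment)
    then obtain w where "w \<in> verts T" "v \<in> verts T" "w \<noteq> v" "e = closed_segment v w"
      using xy closed_segment_commute by metis
    moreover from this have "w \<in> nbrs \<T> v"
      using T(1) by (auto simp: nbrs_iff)
    ultimately show "e \<in> closed_segment v ` nbrs \<T> v"
      by blast
  qed
  ultimately show ?thesis
    unfolding vertex_degree_def by (metis card_image)
qed

section \<open>Connectivity of the domain\<close>

text \<open>A connected open set of dimension at least two stays connected when the finitely many
  common points of the two closed families are deleted, so one family covers it up to
  finitely many points. By density that family covers the closure, and a member of the
  other family would consist of common points only.\<close>

lemma finite_overlap_imp_trivial_split:
  fixes \<Omega> :: "'a::euclidean_space set"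
  assumes dim: "2 \<le> DIM('a)" and \<Omega>: "open \<Omega>" "connected \<Omega>"
    and fin: "finite \<A>" "finite \<B>"
    and closed: "\<And>T. T \<in> \<A> \<union> \<B> \<Longrightarrow> closed T"
    and inf: "\<And>T. T \<in> \<A> \<union> \<B> \<Longrightarrow> infinite T"
    and cover: "\<Union>\<A> \<union> \<Union>\<B> = closure \<Omega>"
    and overlap: "finite (\<Union>\<A> \<inter> \<Union>\<B>)"
  shows "\<A> = {} \<or> \<B> = {}"
proof -
  let ?P = "\<Union>\<A> \<inter> \<Union>\<B>"
  have cl: "closed (\<Union>\<A>)" "closed (\<Union>\<B>)"
    using fin closed by (auto intro: closed_Union)
  have "connected (\<Omega> - ?P)"
    using connected_open_delete_finite[OF \<Omega> dim overlap] .
  moreover have "\<Omega> - ?P \<subseteq> \<Union>\<A> \<union> \<Union>\<B>"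
    using cover closure_subset[of \<Omega>] by blast
  ultimately have "\<Union>\<A> \<inter> (\<Omega> - ?P) = {} \<or> \<Union>\<B> \<inter> (\<Omega> - ?P) = {}"
    using cl unfolding connected_closed by blast
  moreover have empty: "\<D> = {}"
    if cl: "closed (\<Union>\<C>)" and miss: "\<Union>\<D> \<inter> (\<Omega> - ?P) = {}"
      and un: "\<Union>\<C> \<union> \<Union>\<D> = closure \<Omega>" and int: "\<Union>\<C> \<inter> \<Union>\<D> = ?P" and sub: "\<D> \<subseteq> \<A> \<union> \<B>"
    for \<C> \<D>
  proof -
    have "\<Omega> - \<Union>\<C> \<subseteq> ?P"
      using miss un closure_subset[of \<Omega>] by blast
    moreover have "open (\<Omega> - \<Union>\<C>)"
      using \<Omega>(1) cl by (rule open_Diff)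
    ultimately have "\<Omega> - \<Union>\<C> = {}"
      using overlap finite_imp_not_open finite_subset by blast
    then have "closure \<Omega> \<subseteq> \<Union>\<C>"
      using cl by (intro closure_minimal) auto
    then have "\<Union>\<D> \<subseteq> ?P"
      using un int by blast
    then have "finite D" if "D \<in> \<D>" for D
      using that overlap by (meson Union_upper finite_subset)
    then show ?thesis
      using inf sub by blast
  qed
  ultimately show ?thesis
  proof (elim disjE)
    assume "\<Union>\<A> \<inter> (\<Omega> - ?P) = {}"
    then have "\<A> = {}"
      using cover by (intro empty[of \<B> \<A>] cl(2)) (simp_all add: Un_commute Int_commute)
    then show ?thesis ..
  next
    assume "\<Union>\<B> \<inter> (\<Omega> - ?P) = {}"
    then have "\<B> = {}"
      using cover by (intro empty[of \<A> \<B>] cl(1)) simp_all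
    then show ?thesis ..
  qed
qed

section \<open>Growing the vertex set\<close>

text \<open>The degree sum of the subgraph induced by \<open>S\<close> counts every edge between the new vertex \<open>y\<close>
  and \<open>S\<close> twice, once at each end.\<close>

lemma induced_degree_sum_insert:
  fixes N :: "'b \<Rightarrow> 'b set"
  assumes fin: "finite S" and y: "y \<notin> S"
    and sym: "\<And>x z. x \<in> N z \<longleftrightarrow> z \<in> N x" and irrefl: "\<And>x. x \<notin> N x"
  shows "(\<Sum>x\<in>insert y S. card (N x \<inter> insert y S))
    = (\<Sum>x\<in>S. card (N x \<inter> S)) + 2 * card (N y \<inter> S)"
proof -
  have "card (N x \<inter> insert y S) = card (N x \<inter> S) + (if x \<in> N y then 1 else 0)" for x
    using fin y sym[of y x] by (simp add: Int_insert_right)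
  then have "(\<Sum>x\<in>S. card (N x \<inter> insert y S))
      = (\<Sum>x\<in>S. card (N x \<inter> S)) + (\<Sum>x\<in>S. if x \<in> N y then 1 else 0)"
    by (simp add: sum.distrib)
  moreover have "(\<Sum>x\<in>S. if x \<in> N y then 1 else 0) = card (N y \<inter> S)"
    using fin by (simp add: sum.If_cases Int_commute)
  moreover have "N y \<inter> insert y S = N y \<inter> S"
    using irrefl by blast
  ultimately show ?thesis
    using fin y by simp
qed

text \<open>A maximal set between \<open>S0\<close> and \<open>V\<close> that satisfies the bound must be \<open>V\<close>, since a vertex
  supplied by \<open>step\<close> adds at least \<open>2 * 2\<close> to the degree sum.\<close>

lemma induced_degree_sum_greedy:
  fixes N :: "'b \<Rightarrow> 'b set"
  assumes "finite V" and "S0 \<subseteq> V" and start: "4 * card S0 \<le> (\<Sum>x\<in>S0. card (N x \<inter> S0))"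
    and sym: "\<And>x z. x \<in> N z \<longleftrightarrow> z \<in> N x" and irrefl: "\<And>x. x \<notin> N x"
    and step: "\<And>S. S0 \<subseteq> S \<Longrightarrow> S \<subset> V \<Longrightarrow> \<exists>y\<in>V - S. 2 \<le> card (N y \<inter> S)"
  shows "4 * card V \<le> (\<Sum>x\<in>V. card (N x \<inter> V))"
proof -
  define good where
    "good S \<longleftrightarrow> S0 \<subseteq> S \<and> S \<subseteq> V \<and> 4 * card S \<le> (\<Sum>x\<in>S. card (N x \<inter> S))" for S
  have "finite {S. good S}"
    using \<open>finite V\<close> by (rule finite_subset[rotated, OF finite_Pow_iff[THEN iffD2]])
      (auto simp: good_def)
  moreover have "good S0"
    using assms by (simp add: good_def)
  ultimately obtain S where S: "good S" and max: "\<And>S'. good S' \<Longrightarrow> S \<subseteq> S' \<Longrightarrow> S = S'"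
    using finite_has_maximal[of "{S. good S}"] by blast
  have "S = V"
  proof (rule ccontr)
    assume "S \<noteq> V"
    then obtain y where y: "y \<in> V - S" "2 \<le> card (N y \<inter> S)"
      using step[of S] S by (auto simp: good_def)
    have "finite S"
      using S \<open>finite V\<close> finite_subset by (auto simp: good_def)
    then have "good (insert y S)"
      using S y induced_degree_sum_insert[of S y N] sym irrefl by (auto simp: good_def)
    then show False
      using max[of "insert y S"] y by blast
  qed
  then show ?thesis
    using S by (simp add: good_def)
qed

section \<open>The degree bounds\<close>

theorem lemma11:
  fixes \<Omega> :: "(real^3) set" and \<T> :: "(real^3) set set"
  assumes "open \<Omega>" and "bounded \<Omega>" and "polytopal_boundary \<Omega>"
    and "conforming_tetrahedral_triangulation \<Omega> \<T>"
  shows "(\<forall>v\<in>tri_vertices \<T>. v \<notin> frontier \<Omega> \<longrightarrow> vertex_degree \<T> v \<ge> 4) \<and>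
         (path_connected \<Omega> \<and> (\<exists>v\<in>tri_vertices \<T>. v \<notin> frontier \<Omega>) \<longrightarrow>
            average_degree \<T> \<ge> 4)"
proof -
  have tri: "triangulation \<T>"
    using assms(4) by (rule conforming_imp_triangulation)
  have spx: "3 simplex T" if "T \<in> \<T>" for T
    using assms(4) that by (simp add: conforming_tetrahedral_triangulation_def)
  have cover: "\<Union>\<T> = closure \<Omega>"
    using assms(4) by (simp add: conforming_tetrahedral_triangulation_def)
  have finT: "finite \<T>"
    using tri by (simp add: triangulation_def)
  have card4: "card (verts T) = 4" if "T \<in> \<T>" for T
    using simplex_verts(2)[OF spx[OF that]] by simp
  have finV: "finite (tri_vertices \<T>)"
    using finite_tri_vertices[OF assms(4)] .

  have link_ne: "link \<T> B \<noteq> {}" if "T \<in> \<T>" "B \<subseteq> verts T" "card B < 4" for T B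
  proof -
    have "\<not> verts T \<subseteq> B"
      using that card4[OF that(1)] by (metis less_irrefl subset_antisym)
    then show ?thesis
      using that by (auto simp: link_def)
  qed
  have interior: "v \<in> interior (\<Union>\<T>)" if v: "v \<in> tri_vertices \<T>" "v \<notin> frontier \<Omega>" for v
  proof -
    have "v \<in> closure \<Omega>"
      using v(1) cover by (auto simp: tri_vertices_def extreme_point_of_def)
    then have "v \<in> \<Omega>"
      using v(2) assms(1) by (simp add: frontier_def interior_open)
    then show ?thesis
      using cover assms(1) closure_subset by (metis interior_maximal subsetD)
  qed
  have nbrs4: "4 \<le> card (nbrs \<T> v)" if v: "v \<in> tri_vertices \<T>" "v \<notin> frontier \<Omega>" for v
  proof -
    obtain T where T: "T \<in> \<T>" "{v} \<subseteq> verts T"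
      using v by (auto simp: tri_vertices_def)
    show ?thesis
      using face_link_card[OF tri interior[OF v] _ T] link_ne[OF T] by simp
  qed
  have edge3: "3 \<le> card (link \<T> {v, w})"
    if v: "v \<in> tri_vertices \<T>" "v \<notin> frontier \<Omega>" and w: "w \<in> nbrs \<T> v" for v w
  proof -
    obtain T where T: "T \<in> \<T>" "{v, w} \<subseteq> verts T"
      using w by (auto simp: nbrs_iff)
    have "card {v, w} = 2"
      using w by (auto simp: nbrs_iff)
    show ?thesis
      using face_link_card[OF tri interior[OF v] _ T] link_ne[OF T] \<open>card {v, w} = 2\<close> by simp
  qed

  have "average_degree \<T> \<ge> 4"
    if conn: "path_connected \<Omega>" and v: "v \<in> tri_vertices \<T>" "v \<notin> frontier \<Omega>" for v
  proof -
    define S0 where "S0 = insert v (nbrs \<T> v)"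
    have finN: "finite (nbrs \<T> v)"
      by (rule finite_link[OF tri])
    have "4 * card (tri_vertices \<T>)
        \<le> (\<Sum>x\<in>tri_vertices \<T>. card (nbrs \<T> x \<inter> tri_vertices \<T>))"
    proof (rule induced_degree_sum_greedy[of _ S0])
      show "finite (tri_vertices \<T>)"
        by (rule finV)
      show "S0 \<subseteq> tri_vertices \<T>"
        using v by (auto simp: S0_def nbrs_iff tri_vertices_def)
      show "x \<in> nbrs \<T> z \<longleftrightarrow> z \<in> nbrs \<T> x" for x z
        by (rule nbrs_sym)
      show "x \<notin> nbrs \<T> x" for x
        by (simp add: nbrs_iff)
      \<comment> \<open>Besides \<open>v\<close>, a neighbour \<open>w\<close> is adjacent to all vertices around the edge from \<open>v\<close> to \<open>w\<close>.\<close>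
      have deg: "4 \<le> card (nbrs \<T> w \<inter> S0)" if w: "w \<in> nbrs \<T> v" for w
      proof -
        have "insert v (link \<T> {v, w}) \<subseteq> nbrs \<T> w \<inter> S0"
          using w by (auto simp: S0_def link_def)
        then have "card (insert v (link \<T> {v, w})) \<le> card (nbrs \<T> w \<inter> S0)"
          using finN by (intro card_mono) (auto simp: S0_def)
        moreover have "v \<notin> link \<T> {v, w}"
          by (simp add: link_def)
        ultimately show ?thesis
          using edge3[OF v w] finite_link[OF tri] by simp
      qed
      have "v \<notin> nbrs \<T> v"
        by (simp add: nbrs_iff)
      then have "(\<Sum>x\<in>S0. card (nbrs \<T> x \<inter> S0))
          = card (nbrs \<T> v) + (\<Sum>w\<in>nbrs \<T> v. card (nbrs \<T> w \<inter> S0))"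
        using finN by (simp add: S0_def Int_absorb2 subset_insertI)
      moreover have "4 * card (nbrs \<T> v) \<le> (\<Sum>w\<in>nbrs \<T> v. card (nbrs \<T> w \<inter> S0))"
        using sum_mono[of "nbrs \<T> v" "\<lambda>_. 4" "\<lambda>w. card (nbrs \<T> w \<inter> S0)"] deg by simp
      moreover have "card S0 = Suc (card (nbrs \<T> v))"
        using finN \<open>v \<notin> nbrs \<T> v\<close> by (simp add: S0_def)
      ultimately show "4 * card S0 \<le> (\<Sum>x\<in>S0. card (nbrs \<T> x \<inter> S0))"
        using nbrs4[OF v] by simp
    next
      fix S assume S: "S0 \<subseteq> S" "S \<subset> tri_vertices \<T>"
      show "\<exists>y\<in>tri_vertices \<T> - S. 2 \<le> card (nbrs \<T> y \<inter> S)"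
      proof (rule ccontr)
        assume none: "\<not> ?thesis"
        have few: "card (verts T \<inter> S) \<le> 1" if T: "T \<in> \<T>" "\<not> verts T \<subseteq> S" for T
        proof -
          obtain y where y: "y \<in> verts T" "y \<notin> S"
            using T(2) by blast
          then have "verts T \<inter> S \<subseteq> nbrs \<T> y \<inter> S"
            using T(1) by (auto simp: nbrs_iff)
          then have "card (verts T \<inter> S) \<le> card (nbrs \<T> y \<inter> S)"
            using finite_link[OF tri] by (intro card_mono) auto
          moreover have "y \<in> tri_vertices \<T> - S"
            using y T(1) by (auto simp: tri_vertices_def)
          ultimately show ?thesis
            using none by force
        qed
        \<comment> \<open>If no vertex can be added, two tetrahedra of different kinds share at most one vertex.\<close>
        define \<A> where "\<A> = {T \<in> \<T>. verts T \<subseteq> S}"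
        define \<B> where "\<B> = {T \<in> \<T>. \<not> verts T \<subseteq> S}"
        have AB: "\<A> \<union> \<B> = \<T>"
          by (auto simp: \<A>_def \<B>_def)
        have "finite (A \<inter> B)" if "A \<in> \<A>" "B \<in> \<B>" for A B
        proof -
          have mem: "A \<in> \<T>" "B \<in> \<T>" "verts A \<subseteq> S" "\<not> verts B \<subseteq> S"
            using that by (auto simp: \<A>_def \<B>_def)
          have "finite (verts B)"
            using triangulation_hull_verts(2)[OF tri mem(2)] .
          then have "card (verts A \<inter> verts B) \<le> card (verts B \<inter> S)"
            using mem(3) by (intro card_mono) auto
          then have "card (verts A \<inter> verts B) \<le> Suc 0"
            using few[OF mem(2,4)] by simp
          then have "verts A \<inter> verts B = {} \<or> (\<exists>x. verts A \<inter> verts B = {x})"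
            using \<open>finite (verts B)\<close> card_le_Suc0_iff_eq[of "verts A \<inter> verts B"] by blast
          then show ?thesis
            unfolding triangulation_Int_eq_hull[OF tri mem(1,2)] by auto
        qed
        moreover have "finite \<A>" "finite \<B>"
          using finT by (simp_all add: \<A>_def \<B>_def)
        ultimately have "finite (\<Union>A\<in>\<A>. \<Union>B\<in>\<B>. A \<inter> B)"
          by (intro finite_UN_I)
        moreover have "\<Union>\<A> \<inter> \<Union>\<B> = (\<Union>A\<in>\<A>. \<Union>B\<in>\<B>. A \<inter> B)"
          by blast
        ultimately have overlap: "finite (\<Union>\<A> \<inter> \<Union>\<B>)"
          by metis
        have "infinite T" if T: "T \<in> \<T>" for T
        proof
          assume "finite T"
          then have "aff_dim T \<le> 0"
            using connected_finite_iff_sing[OF convex_connected[OF convex_simplex[OF spx[OF T]]]]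
            by auto
          then show False
            using aff_dim_simplex[OF spx[OF T]] by simp
        qed
        moreover have "closed T" if "T \<in> \<T>" for T
          using closed_simplex[OF spx[OF that]] .
        ultimately have "\<A> = {} \<or> \<B> = {}"
          using finite_overlap_imp_trivial_split[of \<Omega> \<A> \<B>] assms(1) overlap cover finT
            path_connected_imp_connected[OF conn]
          unfolding AB Union_Un_distrib[symmetric] by (simp add: \<A>_def \<B>_def)
        moreover have "\<A> \<noteq> {}"
        proof -
          obtain T where T: "T \<in> \<T>" "v \<in> verts T"
            using v by (auto simp: tri_vertices_def)
          then have "verts T \<subseteq> S0"
            by (auto simp: S0_def nbrs_iff)
          then show ?thesis
            using T(1) S(1) unfolding \<A>_def by blast
        qed
        moreover have "\<B> \<noteq> {}"
          using S by (auto simp: \<B>_def tri_vertices_def)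
        ultimately show False
          by blast
      qed
    qed
    also have "\<dots> = (\<Sum>x\<in>tri_vertices \<T>. vertex_degree \<T> x)"
    proof (rule sum.cong[OF refl])
      fix x assume "x \<in> tri_vertices \<T>"
      moreover have "nbrs \<T> x \<inter> tri_vertices \<T> = nbrs \<T> x"
        by (auto simp: nbrs_iff tri_vertices_def)
      ultimately show "card (nbrs \<T> x \<inter> tri_vertices \<T>) = vertex_degree \<T> x"
        using vertex_degree_eq_card_nbrs[OF tri] by simp
    qed
    finally have "4 * real (card (tri_vertices \<T>))
        \<le> (\<Sum>x\<in>tri_vertices \<T>. real (vertex_degree \<T> x))"
      by (metis of_nat_le_iff of_nat_mult of_nat_numeral of_nat_sum)
    moreover have "card (tri_vertices \<T>) > 0"
      using finV v by (auto simp: card_gt_0_iff)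
    ultimately show ?thesis
      by (simp add: average_degree_def pos_le_divide_eq)
  qed
  then show ?thesis
    using nbrs4 vertex_degree_eq_card_nbrs[OF tri] by auto
qed

end
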